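(* The converse of Kuhn's Theorem fails for games of the extensive form with unawareness, even when awareness is weakly increasing along paths: there exists a game of the extensive form with unawareness $\Gamma$ in which every player $i\in I$ has at least two actions at each node of $\mathbf{D}_i$ and condition (DA) holds, such that for every player $i \in I$ and every mixed strategy $\sigma_i \in \Delta(S_i)$ there is an equivalent behavior strategy $\beta_i \in B_i$, but $\Gamma$ does not satisfy perfect recall (i.e. (I6) fails for some player).
   Context: **Base tree.** $I$ is a finite set of players, $0$ denotes nature (possibly absent), and $I^0$ is the set of players including nature. $\bar T$ is a finite rooted directed tree with node set $\bar N = \bar D \cup \bar Z$ (disjoint; $\bar D \neq \emptyset$ decision nodes, $\bar Z$ terminal nodes) and precedence relation $\bar\lessdot$. Each $n \in \bar D$ has a nonempty set $P(n) \subseteq I^0$ of active players, each $i \in P(n)$ has a nonempty finite action set $A_i(n)$, and there is a bijection $\psi_n$ from $\prod_{i \in P(n)} A_i(n)$ onto the immediate successors of $n$. Terminal nodes have no successors and carry payoffs $(u_i(z))_{i\in I}$. **Forest.** A subtree $T$ of $\bar T$ is given by a set of nodes $N \subseteq \bar N$ with $N \cap \bar D \neq \emptyset$ such that $N$ with the restricted precedence relation is a tree. Write $T' \preceq T''$ if the nodes of $T'$ are a subset of the nodes of $T''$. $\mathbf{T}$ is a finite join-semilattice (under $\preceq$) of subtrees of $\bar T$, with top element $\bar T \in \mathbf{T}$, such that: (0) if $n \,\bar\lessdot\, n' \,\bar\lessdot\, n''$ and $n, n''$ are in $T \in \mathbf{T}$, then $n'$ is in $T$; (1) all terminal nodes of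 each $T \in \mathbf{T}$ are in $\bar Z$; (2) for every $T \in \mathbf{T}$, decision node $n \in T$ and $i \in P(n)$ there is a nonempty $A_i^T(n) \subseteq A_i(n)$ such that $\psi_n$ maps $\prod_{i \in P(n)} A_i^T(n)$ bijectively onto the immediate successors of $n$ in $T$; (3) for any $T\in\mathbf{T}$ and decision nodes $n,n' \in T$ with $i \in P(n)\cap P(n')$, if $A_i(n) \cap A_i(n') \neq \emptyset$ then $A_i(n) = A_i(n')$. Appearances of the same node in different trees are treated as distinct objects: $n_T$ is the copy in $T$ of a node $n$ (if it exists in $T$), copies commute ($(n_{T'})_T = n_T$), and $n_T = n$ if $n \in T$. $\mathbf{N}$ and $\mathbf{D}$ are the disjoint unions over $T \in \mathbf{T}$ of all nodes and of all decision nodes; $\mathbf{D}_i$ is the set of nodes in $\mathbf{D}$ at which $i$ is active; $T_n$ is the tree containing $n \in \mathbf{N}$. For a node $n$ of a tree $T$, $A_i(n)$ denotes the actions available at $n$ in $T$, i.e. $A_i^T(n)$. Paths are directed paths within one tree. **Information sets.** For each $n \in \mathbf{D}$ and $i \in P(n)\setminus\{0\}$ there is a nonempty information set $h_i(n) \subseteq \mathbf{D}_i$ such that: (I2) if $n' \in h_i(n)$ then $h_i(n') = h_i(n)$; (I3) if $n' \in h_i(n) \subseteq T'$ and there is a path $n',\dots,n''$ in $T'$ with $i \in P(n') \cap P(n'')$, then $h_i(n'') \subseteq T'$; (I4) if $n' \in h_i(n)$ then $A_i(n') \subseteq A_i(n)$; (I5) for $T \in \mathbf{T}$ and decision nodes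 $n,n' \in T$, if $A_i(n) = A_i(n')$ then $h_i(n') = h_i(n)$; (U0) if $n \in T$ and $i \in P(n)$, there is $T' \in \mathbf{T}$, $T' \preceq T$, with $h_i(n) \subseteq T'$; (U1) if $n \in T$ and $h_i(n) \subseteq T'$, then the copy $n_{T'}$ exists and $n_{T'} \in h_i(n)$; (U4) if $T \preceq T' \preceq T''$, $n \in T''$, $h_i(n) \subseteq T$ and $T'$ contains the copy $n_{T'}$, then $h_i(n_{T'}) = h_i(n)$; (U5) if $T \preceq T' \preceq T''$, $n \in T''$, $h_i(n) \subseteq T'$ and $T$ contains the copy $n_T$, then $h_i(n_T)$ consists of the copies that exist in $T$ of the nodes of $h_i(n)$. These data form a *game of the extensive form with unawareness* $\Gamma$. $H_i$ is the set of all information sets of player $i$ (in all trees). All nodes in an information set $h_i$ have the same action set for $i$, written $A_i(h_i)$. **Condition (DA):** for every player $i \in I$, if there is a path $n,\dots,n'$ in some tree of $\mathbf{T}$ with $i \in P(n) \cap P(n')$, and $h_i(n) \subseteq T'$, $h_i(n') \subseteq T''$, then $T' \preceq T''$. **Perfect recall (I6) for player $i$:** if $i$ is active at two distinct nodes $n_1, n_k$ and there is a path $n_1, n_2, \dots, n_k$ along which $i$ takes action $a_i$ at $n_1$, then for every $n' \in h_i(n_k)$ there are a node $n'_1 \neq n'$ and a path $n'_1, \dots, n'_\ell = n'$ such that $h_i(n'_1) = h_i(n_1)$ and $i$ takes action $a_i$ at $n'_1$ along it. $\Gamma$ satisfies perfect recall if (I6) holds for all $i\in I$. **Strategies.** Pure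 strategies: $S_i = \prod_{h_i \in H_i} A_i(h_i)$ for $i \in I$, and $S_0 = \prod_{n \in \mathbf{D}_0} A_0(n)$ for nature; $S_{-i} = \prod_{j \in I^0\setminus\{i\}} S_j$. Under $s_i$, player $i \in I$ plays $s_i(h_i(n))$ at every node $n \in \mathbf{D}_i$ (even if $h_i(n)$ lies in a tree other than $T_n$); nature plays $s_0(n)$ at $n$. Mixed strategies: $\sigma_i \in \Delta(S_i)$. Behavior strategies of $i \in I$: $\beta_i \in B_i = \prod_{h_i \in H_i} \Delta(A_i(h_i))$; the mixed action at $n \in \mathbf{D}_i$ is $\beta_i(h_i(n))$ (actions outside $A_i(h_i(n))$ get probability $0$), with independent randomization across nodes. **Reaching and equivalence.** A pure profile $s$ reaches a node $n \in T$ if $n$ lies on the path in $T$ that starts at the root of $T$ and follows the actions prescribed by $s$ at each node of $T$. $\rho(n \mid \sigma_i, s_{-i})$ is the $\sigma_i$-probability of the set of $s_i$ such that $(s_i, s_{-i})$ reaches $n$. $\rho(n \mid \beta_i, s_{-i})$ is the probability that $(\beta_i, s_{-i})$ reaches $n$: it is $0$ if at some node strictly preceding $n$ in $T_n$ the action prescribed by $s_{-i}$ for some active player other than $i$ is not the one leading towards $n$, and otherwise is the product, over the nodes $n' \in \mathbf{D}_i$ strictly preceding $n$ in $T_n$, of $\beta_i(h_i(n'))(a)$, where $a$ is $i$'s action at $n'$ leading towards $n$. $\sigma_i$ and $\beta_i$ are *equivalent* if $\rho(n \mid \sigma_i, s_{-i}) = \rho(n \mid \beta_i, s_{-i})$ for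 all $s_{-i} \in S_{-i}$ and all $n \in \mathbf{N}$. *)

theory Defs
  imports "HOL-Probability.Probability_Mass_Function"
begin

section \<open>Games of the extensive form with unawareness\<close>

text \<open>
  Agents are of type \<open>'p option\<close>: \<open>None\<close> is nature and \<open>Some i\<close> is player \<open>i\<close>; nature is absent
  when \<open>None\<close> is nowhere active.  A subtree is identified with its set of nodes, so that
  \<open>T' \<preceq> T''\<close> is \<open>T' \<subseteq> T''\<close>.  The copy \<open>n\<^sub>T\<close> of a node \<open>n\<close> in the tree \<open>T\<close> is the pair \<open>(T, n)\<close>,
  which exists iff \<open>n \<in> T\<close>.
\<close>

type_synonym 'n copy = "'n set \<times> 'n"

text \<open>
  \<open>base_avail \<Gamma> j n\<close> is the action set of \<open>j\<close> at \<open>n\<close> in the base tree and \<open>avail \<Gamma> j (T, n)\<close> the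
  action set $A_j^T(n)$ in the subtree \<open>T\<close>; \<open>move \<Gamma> n\<close> is the bijection $\psi_n$, whose arguments
  are action profiles extensional on the set of active agents; \<open>info \<Gamma> i (T, n)\<close> is $h_i(n_T)$.
\<close>

record ('p, 'n, 'a) ugame =
  players :: "'p set"
  dec_nodes :: "'n set"
  term_nodes :: "'n set"
  prec :: "'n \<Rightarrow> 'n \<Rightarrow> bool"
  active :: "'n \<Rightarrow> 'p option set"
  base_avail :: "'p option \<Rightarrow> 'n \<Rightarrow> 'a set"
  move :: "'n \<Rightarrow> ('p option \<Rightarrow> 'a) \<Rightarrow> 'n"
  payoff :: "'p \<Rightarrow> 'n \<Rightarrow> real"
  trees :: "'n set set"
  avail :: "'p option \<Rightarrow> 'n copy \<Rightarrow> 'a set"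
  info :: "'p \<Rightarrow> 'n copy \<Rightarrow> 'n copy set"

definition nodes :: "('p, 'n, 'a) ugame \<Rightarrow> 'n set" where
  "nodes \<Gamma> = dec_nodes \<Gamma> \<union> term_nodes \<Gamma>"

definition agents :: "('p, 'n, 'a) ugame \<Rightarrow> 'p option set" where
  "agents \<Gamma> = insert None (Some ` players \<Gamma>)"

subsection \<open>Trees and paths\<close>

definition is_root :: "('p, 'n, 'a) ugame \<Rightarrow> 'n set \<Rightarrow> 'n \<Rightarrow> bool" where
  "is_root \<Gamma> T r \<longleftrightarrow> r \<in> T \<and> (\<forall>n\<in>T. n \<noteq> r \<longrightarrow> prec \<Gamma> r n)"

definition is_tree :: "('p, 'n, 'a) ugame \<Rightarrow> 'n set \<Rightarrow> bool" where
  "is_tree \<Gamma> T \<longleftrightarrow>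
     irreflp_on T (prec \<Gamma>) \<and> transp_on T (prec \<Gamma>) \<and>
     (\<exists>r. is_root \<Gamma> T r) \<and>
     (\<forall>n\<in>T. totalp_on {m \<in> T. prec \<Gamma> m n} (prec \<Gamma>))"

definition succs :: "('p, 'n, 'a) ugame \<Rightarrow> 'n set \<Rightarrow> 'n \<Rightarrow> 'n set" where
  "succs \<Gamma> T n = {m \<in> T. prec \<Gamma> n m \<and> \<not> (\<exists>k\<in>T. prec \<Gamma> n k \<and> prec \<Gamma> k m)}"

definition tree_arc :: "('p, 'n, 'a) ugame \<Rightarrow> 'n set \<Rightarrow> 'n \<Rightarrow> 'n \<Rightarrow> bool" where
  "tree_arc \<Gamma> T n m \<longleftrightarrow> n \<in> T \<and> m \<in> succs \<Gamma> T n"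

definition tree_path :: "('p, 'n, 'a) ugame \<Rightarrow> 'n set \<Rightarrow> 'n \<Rightarrow> 'n \<Rightarrow> bool" where
  "tree_path \<Gamma> T = (tree_arc \<Gamma> T)\<^sup>*\<^sup>*"

definition profiles :: "('p, 'n, 'a) ugame \<Rightarrow> 'n copy \<Rightarrow> ('p option \<Rightarrow> 'a) set" where
  "profiles \<Gamma> x = (\<Pi>\<^sub>E j\<in>active \<Gamma> (snd x). avail \<Gamma> j x)"

text \<open>There is a path from \<open>n\<close> to \<open>m \<noteq> n\<close> in \<open>T\<close> along which \<open>j\<close> takes the action \<open>a\<close> at \<open>n\<close>.\<close>

definition leads :: "('p, 'n, 'a) ugame \<Rightarrow> 'n set \<Rightarrow> 'n \<Rightarrow> 'n \<Rightarrow> 'p option \<Rightarrow> 'a \<Rightarrow> bool" where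
  "leads \<Gamma> T n m j a \<longleftrightarrow> (\<exists>f\<in>profiles \<Gamma> (T, n). f j = a \<and> tree_path \<Gamma> T (move \<Gamma> n f) m)"

subsection \<open>The base tree and the forest\<close>

definition base_tree :: "('p, 'n, 'a) ugame \<Rightarrow> bool" where
  "base_tree \<Gamma> \<longleftrightarrow>
     finite (players \<Gamma>) \<and> finite (nodes \<Gamma>) \<and>
     dec_nodes \<Gamma> \<inter> term_nodes \<Gamma> = {} \<and> dec_nodes \<Gamma> \<noteq> {} \<and>
     is_tree \<Gamma> (nodes \<Gamma>) \<and>
     (\<forall>n\<in>dec_nodes \<Gamma>.
        active \<Gamma> n \<noteq> {} \<and> active \<Gamma> n \<subseteq> agents \<Gamma> \<and>
        (\<forall>j\<in>active \<Gamma> n. finite (base_avail \<Gamma> j n) \<and> base_avail \<Gamma> j n \<noteq> {}) \<and>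
        bij_betw (move \<Gamma> n) (\<Pi>\<^sub>E j\<in>active \<Gamma> n. base_avail \<Gamma> j n) (succs \<Gamma> (nodes \<Gamma>) n)) \<and>
     (\<forall>z\<in>term_nodes \<Gamma>. succs \<Gamma> (nodes \<Gamma>) z = {})"

definition subtree :: "('p, 'n, 'a) ugame \<Rightarrow> 'n set \<Rightarrow> bool" where
  "subtree \<Gamma> T \<longleftrightarrow> T \<subseteq> nodes \<Gamma> \<and> T \<inter> dec_nodes \<Gamma> \<noteq> {} \<and> is_tree \<Gamma> T"

definition join_semilattice :: "'n set set \<Rightarrow> bool" where
  "join_semilattice \<T> \<longleftrightarrow>
     (\<forall>T\<in>\<T>. \<forall>T'\<in>\<T>. \<exists>J\<in>\<T>. T \<subseteq> J \<and> T' \<subseteq> J \<and> (\<forall>K\<in>\<T>. T \<subseteq> K \<and> T' \<subseteq> K \<longrightarrow> J \<subseteq> K))"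

definition all_copies :: "('p, 'n, 'a) ugame \<Rightarrow> 'n copy set" where
  "all_copies \<Gamma> = {(T, n). T \<in> trees \<Gamma> \<and> n \<in> T}"

definition dec_copies :: "('p, 'n, 'a) ugame \<Rightarrow> 'n copy set" where
  "dec_copies \<Gamma> = {(T, n). T \<in> trees \<Gamma> \<and> n \<in> T \<and> n \<in> dec_nodes \<Gamma>}"

definition dec_copies_of :: "('p, 'n, 'a) ugame \<Rightarrow> 'p option \<Rightarrow> 'n copy set" where
  "dec_copies_of \<Gamma> j = {x \<in> dec_copies \<Gamma>. j \<in> active \<Gamma> (snd x)}"

definition forest :: "('p, 'n, 'a) ugame \<Rightarrow> bool" where
  "forest \<Gamma> \<longleftrightarrow>
     finite (trees \<Gamma>) \<and> (\<forall>T\<in>trees \<Gamma>. subtree \<Gamma> T) \<and>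
     join_semilattice (trees \<Gamma>) \<and> nodes \<Gamma> \<in> trees \<Gamma> \<and>
     (\<forall>T\<in>trees \<Gamma>. \<forall>n\<in>T. \<forall>n''\<in>T. \<forall>n'\<in>nodes \<Gamma>.
        prec \<Gamma> n n' \<and> prec \<Gamma> n' n'' \<longrightarrow> n' \<in> T) \<and>
     (\<forall>T\<in>trees \<Gamma>. \<forall>n\<in>T. succs \<Gamma> T n = {} \<longrightarrow> n \<in> term_nodes \<Gamma>) \<and>
     (\<forall>(T, n)\<in>dec_copies \<Gamma>.
        (\<forall>j\<in>active \<Gamma> n. avail \<Gamma> j (T, n) \<noteq> {} \<and> avail \<Gamma> j (T, n) \<subseteq> base_avail \<Gamma> j n) \<and>
        bij_betw (move \<Gamma> n) (profiles \<Gamma> (T, n)) (succs \<Gamma> T n)) \<and>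
     (\<forall>T n n' j. (T, n) \<in> dec_copies_of \<Gamma> j \<and> (T, n') \<in> dec_copies_of \<Gamma> j \<and>
        avail \<Gamma> j (T, n) \<inter> avail \<Gamma> j (T, n') \<noteq> {} \<longrightarrow>
        avail \<Gamma> j (T, n) = avail \<Gamma> j (T, n'))"

subsection \<open>Information sets\<close>

text \<open>\<open>lies_in h T\<close> renders \<open>h \<subseteq> T\<close> for a set \<open>h\<close> of copies.\<close>

definition lies_in :: "'n copy set \<Rightarrow> 'n set \<Rightarrow> bool" where
  "lies_in h T \<longleftrightarrow> h \<subseteq> {T} \<times> T"

definition info_sets_wf :: "('p, 'n, 'a) ugame \<Rightarrow> 'p \<Rightarrow> bool" where
  "info_sets_wf \<Gamma> i \<longleftrightarrow>
     (\<forall>x\<in>dec_copies_of \<Gamma> (Some i).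
        info \<Gamma> i x \<noteq> {} \<and> info \<Gamma> i x \<subseteq> dec_copies_of \<Gamma> (Some i))"

definition I2 :: "('p, 'n, 'a) ugame \<Rightarrow> 'p \<Rightarrow> bool" where
  "I2 \<Gamma> i \<longleftrightarrow>
     (\<forall>x\<in>dec_copies_of \<Gamma> (Some i). \<forall>y\<in>info \<Gamma> i x. info \<Gamma> i y = info \<Gamma> i x)"

definition I3 :: "('p, 'n, 'a) ugame \<Rightarrow> 'p \<Rightarrow> bool" where
  "I3 \<Gamma> i \<longleftrightarrow>
     (\<forall>x\<in>dec_copies_of \<Gamma> (Some i). \<forall>T'\<in>trees \<Gamma>. \<forall>n' n''.
        (T', n') \<in> info \<Gamma> i x \<and> lies_in (info \<Gamma> i x) T' \<and>
        (T', n'') \<in> dec_copies_of \<Gamma> (Some i) \<and> tree_path \<Gamma> T' n' n'' \<longrightarrow>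
        lies_in (info \<Gamma> i (T', n'')) T')"

definition I4 :: "('p, 'n, 'a) ugame \<Rightarrow> 'p \<Rightarrow> bool" where
  "I4 \<Gamma> i \<longleftrightarrow>
     (\<forall>x\<in>dec_copies_of \<Gamma> (Some i). \<forall>y\<in>info \<Gamma> i x.
        avail \<Gamma> (Some i) y \<subseteq> avail \<Gamma> (Some i) x)"

definition I5 :: "('p, 'n, 'a) ugame \<Rightarrow> 'p \<Rightarrow> bool" where
  "I5 \<Gamma> i \<longleftrightarrow>
     (\<forall>T n n'. (T, n) \<in> dec_copies_of \<Gamma> (Some i) \<and> (T, n') \<in> dec_copies_of \<Gamma> (Some i) \<and>
        avail \<Gamma> (Some i) (T, n) = avail \<Gamma> (Some i) (T, n') \<longrightarrow>
        info \<Gamma> i (T, n') = info \<Gamma> i (T, n))"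

definition U0 :: "('p, 'n, 'a) ugame \<Rightarrow> 'p \<Rightarrow> bool" where
  "U0 \<Gamma> i \<longleftrightarrow>
     (\<forall>(T, n)\<in>dec_copies_of \<Gamma> (Some i).
        \<exists>T'\<in>trees \<Gamma>. T' \<subseteq> T \<and> lies_in (info \<Gamma> i (T, n)) T')"

definition U1 :: "('p, 'n, 'a) ugame \<Rightarrow> 'p \<Rightarrow> bool" where
  "U1 \<Gamma> i \<longleftrightarrow>
     (\<forall>(T, n)\<in>dec_copies_of \<Gamma> (Some i). \<forall>T'\<in>trees \<Gamma>.
        lies_in (info \<Gamma> i (T, n)) T' \<longrightarrow> n \<in> T' \<and> (T', n) \<in> info \<Gamma> i (T, n))"

definition U4 :: "('p, 'n, 'a) ugame \<Rightarrow> 'p \<Rightarrow> bool" where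
  "U4 \<Gamma> i \<longleftrightarrow>
     (\<forall>T\<in>trees \<Gamma>. \<forall>T'\<in>trees \<Gamma>. \<forall>T''\<in>trees \<Gamma>. \<forall>n.
        T \<subseteq> T' \<and> T' \<subseteq> T'' \<and> (T'', n) \<in> dec_copies_of \<Gamma> (Some i) \<and>
        lies_in (info \<Gamma> i (T'', n)) T \<and> n \<in> T' \<longrightarrow>
        info \<Gamma> i (T', n) = info \<Gamma> i (T'', n))"

definition U5 :: "('p, 'n, 'a) ugame \<Rightarrow> 'p \<Rightarrow> bool" where
  "U5 \<Gamma> i \<longleftrightarrow>
     (\<forall>T\<in>trees \<Gamma>. \<forall>T'\<in>trees \<Gamma>. \<forall>T''\<in>trees \<Gamma>. \<forall>n.
        T \<subseteq> T' \<and> T' \<subseteq> T'' \<and> (T'', n) \<in> dec_copies_of \<Gamma> (Some i) \<and>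
        lies_in (info \<Gamma> i (T'', n)) T' \<and> n \<in> T \<longrightarrow>
        info \<Gamma> i (T, n) = {(T, m) | m. (T', m) \<in> info \<Gamma> i (T'', n) \<and> m \<in> T})"

definition unawareness_game :: "('p, 'n, 'a) ugame \<Rightarrow> bool" where
  "unawareness_game \<Gamma> \<longleftrightarrow>
     base_tree \<Gamma> \<and> forest \<Gamma> \<and>
     (\<forall>i\<in>players \<Gamma>.
        info_sets_wf \<Gamma> i \<and> I2 \<Gamma> i \<and> I3 \<Gamma> i \<and> I4 \<Gamma> i \<and> I5 \<Gamma> i \<and>
        U0 \<Gamma> i \<and> U1 \<Gamma> i \<and> U4 \<Gamma> i \<and> U5 \<Gamma> i)"

subsection \<open>Condition (DA), perfect recall\<close>

definition DA :: "('p, 'n, 'a) ugame \<Rightarrow> bool" where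
  "DA \<Gamma> \<longleftrightarrow>
     (\<forall>i\<in>players \<Gamma>. \<forall>T n n'. \<forall>T'\<in>trees \<Gamma>. \<forall>T''\<in>trees \<Gamma>.
        (T, n) \<in> dec_copies_of \<Gamma> (Some i) \<and> (T, n') \<in> dec_copies_of \<Gamma> (Some i) \<and>
        tree_path \<Gamma> T n n' \<and> lies_in (info \<Gamma> i (T, n)) T' \<and> lies_in (info \<Gamma> i (T, n')) T'' \<longrightarrow>
        T' \<subseteq> T'')"

definition I6 :: "('p, 'n, 'a) ugame \<Rightarrow> 'p \<Rightarrow> bool" where
  "I6 \<Gamma> i \<longleftrightarrow>
     (\<forall>T n\<^sub>1 n\<^sub>k a.
        (T, n\<^sub>1) \<in> dec_copies_of \<Gamma> (Some i) \<and> (T, n\<^sub>k) \<in> dec_copies_of \<Gamma> (Some i) \<and>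
        n\<^sub>1 \<noteq> n\<^sub>k \<and> leads \<Gamma> T n\<^sub>1 n\<^sub>k (Some i) a \<longrightarrow>
        (\<forall>(T', n')\<in>info \<Gamma> i (T, n\<^sub>k).
           \<exists>m. (T', m) \<in> dec_copies_of \<Gamma> (Some i) \<and> m \<noteq> n' \<and>
             leads \<Gamma> T' m n' (Some i) a \<and> info \<Gamma> i (T', m) = info \<Gamma> i (T, n\<^sub>1)))"

definition perfect_recall :: "('p, 'n, 'a) ugame \<Rightarrow> bool" where
  "perfect_recall \<Gamma> \<longleftrightarrow> (\<forall>i\<in>players \<Gamma>. I6 \<Gamma> i)"

subsection \<open>Strategies\<close>

definition info_sets :: "('p, 'n, 'a) ugame \<Rightarrow> 'p \<Rightarrow> 'n copy set set" where
  "info_sets \<Gamma> i = info \<Gamma> i ` dec_copies_of \<Gamma> (Some i)"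

text \<open>By (I2) and (I4) all members of the union are equal.\<close>

definition info_avail :: "('p, 'n, 'a) ugame \<Rightarrow> 'p \<Rightarrow> 'n copy set \<Rightarrow> 'a set" where
  "info_avail \<Gamma> i h = (\<Union>x\<in>h. avail \<Gamma> (Some i) x)"

definition pure :: "('p, 'n, 'a) ugame \<Rightarrow> 'p \<Rightarrow> ('n copy set \<Rightarrow> 'a) set" where
  "pure \<Gamma> i = (\<Pi>\<^sub>E h\<in>info_sets \<Gamma> i. info_avail \<Gamma> i h)"

definition pure_nature :: "('p, 'n, 'a) ugame \<Rightarrow> ('n copy \<Rightarrow> 'a) set" where
  "pure_nature \<Gamma> = (\<Pi>\<^sub>E x\<in>dec_copies_of \<Gamma> None. avail \<Gamma> None x)"

text \<open>Strategies of nature and of the other players have different types, hence a pair.\<close>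

definition pure_others ::
  "('p, 'n, 'a) ugame \<Rightarrow> 'p \<Rightarrow> (('n copy \<Rightarrow> 'a) \<times> ('p \<Rightarrow> 'n copy set \<Rightarrow> 'a)) set" where
  "pure_others \<Gamma> i = pure_nature \<Gamma> \<times> (\<Pi>\<^sub>E j\<in>players \<Gamma> - {i}. pure \<Gamma> j)"

definition mixed :: "('p, 'n, 'a) ugame \<Rightarrow> 'p \<Rightarrow> ('n copy set \<Rightarrow> 'a) pmf set" where
  "mixed \<Gamma> i = {\<sigma>. set_pmf \<sigma> \<subseteq> pure \<Gamma> i}"

definition behavior :: "('p, 'n, 'a) ugame \<Rightarrow> 'p \<Rightarrow> ('n copy set \<Rightarrow> 'a pmf) set" where
  "behavior \<Gamma> i = (\<Pi>\<^sub>E h\<in>info_sets \<Gamma> i. {p. set_pmf p \<subseteq> info_avail \<Gamma> i h})"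

subsection \<open>Reaching nodes and equivalence\<close>

fun prescribed ::
  "('p, 'n, 'a) ugame \<Rightarrow> ('n copy \<Rightarrow> 'a) \<Rightarrow> ('p \<Rightarrow> 'n copy set \<Rightarrow> 'a) \<Rightarrow> 'n copy \<Rightarrow> 'p option \<Rightarrow> 'a"
where
  "prescribed \<Gamma> s\<^sub>0 s x None = s\<^sub>0 x"
| "prescribed \<Gamma> s\<^sub>0 s x (Some i) = s i (info \<Gamma> i x)"

inductive reaches ::
  "('p, 'n, 'a) ugame \<Rightarrow> ('n copy \<Rightarrow> 'a) \<Rightarrow> ('p \<Rightarrow> 'n copy set \<Rightarrow> 'a) \<Rightarrow> 'n set \<Rightarrow> 'n \<Rightarrow> bool"
  for \<Gamma> s\<^sub>0 s T where
  root: "is_root \<Gamma> T r \<Longrightarrow> reaches \<Gamma> s\<^sub>0 s T r"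
| step: "reaches \<Gamma> s\<^sub>0 s T n \<Longrightarrow> n \<in> dec_nodes \<Gamma> \<Longrightarrow>
    reaches \<Gamma> s\<^sub>0 s T (move \<Gamma> n (\<lambda>j\<in>active \<Gamma> n. prescribed \<Gamma> s\<^sub>0 s (T, n) j))"

definition rho_mixed ::
  "('p, 'n, 'a) ugame \<Rightarrow> 'p \<Rightarrow> 'n copy \<Rightarrow> ('n copy set \<Rightarrow> 'a) pmf \<Rightarrow>
   ('n copy \<Rightarrow> 'a) \<times> ('p \<Rightarrow> 'n copy set \<Rightarrow> 'a) \<Rightarrow> real" where
  "rho_mixed \<Gamma> i x \<sigma> s = measure_pmf.prob \<sigma>
     {t \<in> pure \<Gamma> i. reaches \<Gamma> (fst s) ((snd s)(i := t)) (fst x) (snd x)}"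

definition before :: "('p, 'n, 'a) ugame \<Rightarrow> 'n copy \<Rightarrow> 'n set" where
  "before \<Gamma> x = {m \<in> fst x. prec \<Gamma> m (snd x)}"

definition rho_behavior ::
  "('p, 'n, 'a) ugame \<Rightarrow> 'p \<Rightarrow> 'n copy \<Rightarrow> ('n copy set \<Rightarrow> 'a pmf) \<Rightarrow>
   ('n copy \<Rightarrow> 'a) \<times> ('p \<Rightarrow> 'n copy set \<Rightarrow> 'a) \<Rightarrow> real" where
  "rho_behavior \<Gamma> i x \<beta> s =
     (let T = fst x; n = snd x in
      if \<exists>m\<in>before \<Gamma> x. \<exists>j\<in>active \<Gamma> m - {Some i}.
           \<not> leads \<Gamma> T m n j (prescribed \<Gamma> (fst s) (snd s) (T, m) j)
      then 0
      else \<Prod>m | m \<in> before \<Gamma> x \<and> (T, m) \<in> dec_copies_of \<Gamma> (Some i).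
             pmf (\<beta> (info \<Gamma> i (T, m))) (THE a. leads \<Gamma> T m n (Some i) a))"

definition equivalent ::
  "('p, 'n, 'a) ugame \<Rightarrow> 'p \<Rightarrow> ('n copy set \<Rightarrow> 'a) pmf \<Rightarrow> ('n copy set \<Rightarrow> 'a pmf) \<Rightarrow> bool" where
  "equivalent \<Gamma> i \<sigma> \<beta> \<longleftrightarrow>
     (\<forall>s\<in>pure_others \<Gamma> i. \<forall>x\<in>all_copies \<Gamma>. rho_mixed \<Gamma> i x \<sigma> s = rho_behavior \<Gamma> i x \<beta> s)"

end

theory Submission
  imports Defs
begin

text \<open>
  There is a single player.  At the root the full tree offers the actions 1, 2, 3, but the player
  only perceives the lower tree, in which action 3 is missing.  Action 1 ends the game, and after
  actions 2 and 3 the player has a further move, at two nodes that share an information set of the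
  full tree.  Perfect recall fails at this information set, since one of its nodes follows action 3
  and the other does not.  No strategy ever plays action 3, however, so every node that is reached
  after the second move follows action 2, and conditioning a mixed strategy on action 2 at the
  root yields an equivalent behavior strategy.
\<close>

section \<open>Trees, information sets and the game\<close>

definition full_tree :: "nat set" where "full_tree = {0, 1, 2, 3, 4, 5, 6, 7}"

definition low_tree :: "nat set" where "low_tree = {0, 1, 2, 4, 5}"

definition root_info :: "nat copy set" where "root_info = {(low_tree, 0)}"

definition full_info :: "nat copy set" where "full_info = {(full_tree, 2), (full_tree, 3)}"

definition low_info :: "nat copy set" where "low_info = {(low_tree, 2)}"

text \<open>The bound 7 confines the relation to the nodes, so that it describes the nontrivial
  paths of \<open>full_tree\<close> without any membership hypothesis.\<close>

definition tree_prec :: "nat \<Rightarrow> nat \<Rightarrow> bool" where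
  "tree_prec m n \<longleftrightarrow>
    m = 0 \<and> 0 < n \<and> n \<le> 7 \<or> m = 2 \<and> (n = 4 \<or> n = 5) \<or> m = 3 \<and> (n = 6 \<or> n = 7)"

text \<open>
  Actions are labelled by the node they lead to, except that at node 3 the actions 4 and 5 lead to
  6 and 7: nodes in a common information set must have the same actions.
\<close>

definition forgetful_game :: "(nat, nat, nat) ugame" where
  "forgetful_game =
    \<lparr>players = {0},
     dec_nodes = {0, 2, 3},
     term_nodes = {1, 4, 5, 6, 7},
     prec = tree_prec,
     active = (\<lambda>_. {Some 0}),
     base_avail = (\<lambda>_ n. if n = 0 then {1, 2, 3} else {4, 5}),
     move = (\<lambda>n f. f (Some 0) + (if n = 3 then 2 else 0)),
     payoff = (\<lambda>_ _. 0),
     trees = {low_tree, full_tree},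
     avail = (\<lambda>_ (T, n). if n = 0 then (if T = full_tree then {1, 2, 3} else {1, 2}) else {4, 5}),
     info = (\<lambda>_ (T, n). if n = 0 then root_info else if T = full_tree then full_info else low_info)\<rparr>"

lemma forgetful_game_simps [simp]:
  "players forgetful_game = {0}"
  "dec_nodes forgetful_game = {0, 2, 3}"
  "term_nodes forgetful_game = {1, 4, 5, 6, 7}"
  "prec forgetful_game = tree_prec"
  "active forgetful_game n = {Some 0}"
  "base_avail forgetful_game j n = (if n = 0 then {1, 2, 3} else {4, 5})"
  "move forgetful_game n f = f (Some 0) + (if n = 3 then 2 else 0)"
  "trees forgetful_game = {low_tree, full_tree}"
  "avail forgetful_game j (T, n) =
    (if n = 0 then (if T = full_tree then {1, 2, 3} else {1, 2}) else {4, 5})"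
  "info forgetful_game i (T, n) =
    (if n = 0 then root_info else if T = full_tree then full_info else low_info)"
  by (simp_all add: forgetful_game_def)

lemma nodes_forgetful_game [simp]: "nodes forgetful_game = full_tree"
  by (auto simp: nodes_def full_tree_def)

lemma mem_trees [simp]:
  "n \<in> full_tree \<longleftrightarrow> n \<in> {0, 1, 2, 3, 4, 5, 6, 7}" "n \<in> low_tree \<longleftrightarrow> n \<in> {0, 1, 2, 4, 5}"
  by (simp_all only: low_tree_def full_tree_def)

lemma not_full_tree_subset_low_tree [simp]: "\<not> full_tree \<subseteq> low_tree"
proof
  assume "full_tree \<subseteq> low_tree"
  then have "3 \<in> low_tree" by (rule subsetD) simp
  then show False by simp
qed

lemma low_tree_subset_full_tree [simp]: "low_tree \<subseteq> full_tree"
  by (rule subsetI) auto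

lemma low_tree_neq_full_tree [simp]: "low_tree \<noteq> full_tree" "full_tree \<noteq> low_tree"
  using not_full_tree_subset_low_tree by (metis subset_refl)+

lemma mem_info [simp]:
  "(T, n) \<in> root_info \<longleftrightarrow> T = low_tree \<and> n = 0"
  "(T, n) \<in> full_info \<longleftrightarrow> T = full_tree \<and> (n = 2 \<or> n = 3)"
  "(T, n) \<in> low_info \<longleftrightarrow> T = low_tree \<and> n = 2"
  by (auto simp: root_info_def full_info_def low_info_def)

lemma info_distinct [simp]:
  "root_info \<noteq> full_info" "root_info \<noteq> low_info" "full_info \<noteq> low_info"
  "full_info \<noteq> root_info" "low_info \<noteq> root_info" "low_info \<noteq> full_info"
  using mem_info(1)[of low_tree 0] mem_info(2,3)[of low_tree 0] mem_info(2,3)[of low_tree 2]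
  by (metis low_tree_neq_full_tree(1) zero_neq_numeral)+

section \<open>Precedence, successors and paths\<close>

lemma tree_prec_cases:
  "tree_prec m n \<Longrightarrow>
    m = 0 \<and> n \<in> {1, 2, 3, 4, 5, 6, 7} \<or> m = 2 \<and> n \<in> {4, 5} \<or> m = 3 \<and> n \<in> {6, 7}"
  unfolding tree_prec_def insert_iff empty_iff by presburger

lemma tree_prec_irrefl: "\<not> tree_prec n n"
  by (auto simp: tree_prec_def)

lemma tree_prec_trans: "tree_prec k m \<Longrightarrow> tree_prec m n \<Longrightarrow> tree_prec k n"
  unfolding tree_prec_def by linarith

text \<open>No node has both 2 and 3 above it. Hence two distinct predecessors of a node include 0,
  which precedes the other one.\<close>

lemma tree_prec_total:
  "tree_prec k n \<Longrightarrow> tree_prec m n \<Longrightarrow> k \<noteq> m \<Longrightarrow> tree_prec k m \<or> tree_prec m k"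
  unfolding tree_prec_def by (elim disjE conjE) simp_all

lemma is_root_iff [simp]:
  "is_root forgetful_game full_tree r \<longleftrightarrow> r = 0"
  "is_root forgetful_game low_tree r \<longleftrightarrow> r = 0"
proof -
  have "is_root forgetful_game full_tree 0" "is_root forgetful_game low_tree 0"
    by (simp_all add: is_root_def full_tree_def low_tree_def tree_prec_def)
  \<comment> \<open>Another root would have to precede 0, which has no predecessor.\<close>
  moreover have "r = 0" if "is_root forgetful_game T r" "0 \<in> T" for T
    using that by (auto simp: is_root_def tree_prec_def)
  ultimately show "is_root forgetful_game full_tree r \<longleftrightarrow> r = 0"
    "is_root forgetful_game low_tree r \<longleftrightarrow> r = 0"
    by (auto simp: full_tree_def low_tree_def)
qed

lemma is_tree_forgetful_game:
  assumes "T \<in> {low_tree, full_tree}"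
  shows "is_tree forgetful_game T"
proof -
  have "irreflp_on T tree_prec" "transp_on T tree_prec"
    "totalp_on {m \<in> T. tree_prec m n} tree_prec" for n
    by (auto intro!: irreflp_onI transp_onI totalp_onI
        intro: tree_prec_trans dest: tree_prec_total simp: tree_prec_irrefl)
  moreover have "\<exists>r. is_root forgetful_game T r"
    using assms by auto
  ultimately show ?thesis
    by (simp add: is_tree_def)
qed

text \<open>Evaluates a comprehension over an explicitly listed set element by element; the
  immediate successors are computed this way.\<close>

lemma filter_insert_eq: "{x \<in> insert a B. P x} = (if P a then insert a {x \<in> B. P x} else {x \<in> B. P x})"
  by auto

lemma succs_full_tree:
  "succs forgetful_game full_tree n =
    (if n = 0 then {1, 2, 3} else if n = 2 then {4, 5} else if n = 3 then {6, 7} else {})"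
proof -
  consider "n = 0" | "n = 2" | "n = 3" | "n \<notin> {0, 2, 3}" by blast
  then show ?thesis
    unfolding succs_def full_tree_def filter_insert_eq
    by cases (simp_all add: tree_prec_def)
qed

lemma succs_low_tree:
  "succs forgetful_game low_tree n =
    (if n = 0 then {1, 2} else if n = 2 then {4, 5} else {})"
proof -
  consider "n = 0" | "n = 2" | "n = 3" | "n \<notin> {0, 2, 3}" by blast
  then show ?thesis
    unfolding succs_def low_tree_def filter_insert_eq
    by cases (simp_all add: tree_prec_def)
qed

lemma tree_path_refl: "tree_path \<Gamma> T n n"
  by (simp add: tree_path_def)

lemma tree_path_arc: "tree_arc \<Gamma> T n m \<Longrightarrow> tree_path \<Gamma> T n m"
  by (simp add: tree_path_def r_into_rtranclp)

lemma tree_path_arc_path: "tree_arc \<Gamma> T n k \<Longrightarrow> tree_path \<Gamma> T k m \<Longrightarrow> tree_path \<Gamma> T n m"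
  by (simp add: tree_path_def converse_rtranclp_into_rtranclp)

lemma tree_path_full_tree:
  "tree_path forgetful_game full_tree n m \<longleftrightarrow> n = m \<or> tree_prec n m"
proof
  assume "tree_path forgetful_game full_tree n m"
  then show "n = m \<or> tree_prec n m"
    unfolding tree_path_def
    by (induction rule: rtranclp_induct)
      (auto simp: tree_arc_def succs_full_tree tree_prec_def split: if_splits)
next
  have arc: "tree_arc forgetful_game full_tree 0 1" "tree_arc forgetful_game full_tree 0 2"
    "tree_arc forgetful_game full_tree 0 3" "tree_arc forgetful_game full_tree 2 4"
    "tree_arc forgetful_game full_tree 2 5" "tree_arc forgetful_game full_tree 3 6"
    "tree_arc forgetful_game full_tree 3 7"
    by (auto simp: tree_arc_def succs_full_tree)
  \<comment> \<open>Prepending arcs to single arcs suffices, since any two nodes related by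
    \<open>tree_prec\<close> are at most two arcs apart.\<close>
  note [intro] = arc[THEN tree_path_arc] arc[THEN tree_path_arc_path]
  assume "n = m \<or> tree_prec n m"
  then show "tree_path forgetful_game full_tree n m"
    by (auto simp: tree_path_refl dest!: tree_prec_cases)
qed

text \<open>The membership conditions are essential here: \<open>tree_prec\<close> also relates 0 to
  3, 6 and 7, which lie outside \<open>low_tree\<close>.\<close>

lemma tree_path_low_tree:
  "tree_path forgetful_game low_tree n m \<longleftrightarrow> n = m \<or> n \<in> low_tree \<and> m \<in> low_tree \<and> tree_prec n m"
proof
  assume "tree_path forgetful_game low_tree n m"
  then show "n = m \<or> n \<in> low_tree \<and> m \<in> low_tree \<and> tree_prec n m"
    unfolding tree_path_def
    by (induction rule: rtranclp_induct)
      (auto simp: tree_arc_def succs_low_tree tree_prec_def split: if_splits)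
next
  have arc: "tree_arc forgetful_game low_tree 0 1" "tree_arc forgetful_game low_tree 0 2"
    "tree_arc forgetful_game low_tree 2 4" "tree_arc forgetful_game low_tree 2 5"
    by (auto simp: tree_arc_def succs_low_tree)
  note [intro] = arc[THEN tree_path_arc] arc[THEN tree_path_arc_path]
  assume "n = m \<or> n \<in> low_tree \<and> m \<in> low_tree \<and> tree_prec n m"
  then have "n = m \<or> n = 0 \<and> m \<in> {1, 2, 4, 5} \<or> n = 2 \<and> m \<in> {4, 5}"
    unfolding mem_trees insert_iff empty_iff tree_prec_def by presburger
  then show "tree_path forgetful_game low_tree n m"
    by (auto simp: tree_path_refl)
qed

section \<open>Action profiles and decision nodes\<close>

lemma PiE_singleton_eq_image: "(\<Pi>\<^sub>E j\<in>{k}. B j) = (\<lambda>a. \<lambda>j\<in>{k}. a) ` B k"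
  unfolding PiE_over_singleton_iff by (rule UNION_singleton_eq_range)

text \<open>A profile of a single active agent amounts to one action, so the bijectivity of
  \<open>move\<close> can be checked on actions.\<close>

lemma bij_betw_eval_singleton:
  assumes "inj_on g (B k)" "g ` B k = C"
  shows "bij_betw (\<lambda>f. g (f k)) (\<Pi>\<^sub>E j\<in>{k}. B j) C"
  using assms unfolding PiE_singleton_eq_image bij_betw_def
  by (auto simp: inj_on_def image_image)

lemma profiles_eq:
  "profiles forgetful_game (T, n) =
    (\<lambda>a. \<lambda>j\<in>{Some 0}. a) ` avail forgetful_game (Some 0) (T, n)"
  unfolding profiles_def forgetful_game_simps(5) by (rule PiE_singleton_eq_image)

lemma leads_iff:
  "leads forgetful_game T n m (Some 0) a \<longleftrightarrow>
    a \<in> avail forgetful_game (Some 0) (T, n) \<and>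
    tree_path forgetful_game T (a + (if n = 3 then 2 else 0)) m"
  unfolding leads_def profiles_eq bex_simps(7) forgetful_game_simps(7) by fastforce

lemma dec_copies_of_iff:
  "(T, n) \<in> dec_copies_of forgetful_game (Some i) \<longleftrightarrow>
    i = 0 \<and> (T = low_tree \<and> n \<in> {0, 2} \<or> T = full_tree \<and> n \<in> {0, 2, 3})"
  unfolding dec_copies_of_def dec_copies_def by auto

text \<open>With the five copies listed, a bounded quantifier over them splits into five instances
  that simplification can decide.\<close>

lemma dec_copies_of_eq:
  "dec_copies_of forgetful_game (Some 0) =
    {(low_tree, 0), (low_tree, 2), (full_tree, 0), (full_tree, 2), (full_tree, 3)}"
proof (rule set_eqI)
  fix x :: "nat copy"
  obtain T n where x: "x = (T, n)" by (cases x)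
  have 1: "x \<in> dec_copies_of forgetful_game (Some 0) \<longleftrightarrow> (T = low_tree \<and> n \<in> {0, 2} \<or> T = full_tree \<and> n \<in> {0, 2, 3})"
    unfolding x dec_copies_of_iff by blast
  show "x \<in> dec_copies_of forgetful_game (Some 0) \<longleftrightarrow>
    x \<in> {(low_tree, 0), (low_tree, 2), (full_tree, 0), (full_tree, 2), (full_tree, 3)}"
    unfolding 1 unfolding x insert_iff prod.inject by blast
qed

section \<open>Base tree and forest\<close>

lemma base_tree_forgetful_game: "base_tree forgetful_game"
proof -
  have "bij_betw (move forgetful_game n)
      (\<Pi>\<^sub>E j\<in>active forgetful_game n. base_avail forgetful_game j n)
      (succs forgetful_game (nodes forgetful_game) n)"
    if "n \<in> dec_nodes forgetful_game" for n
    unfolding forgetful_game_simps(5,7)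
    by (rule bij_betw_eval_singleton) (use that in \<open>auto simp: succs_full_tree\<close>)
  moreover have "finite full_tree"
    by (simp add: full_tree_def)
  ultimately show ?thesis
    unfolding base_tree_def
    by (auto simp: is_tree_forgetful_game succs_full_tree agents_def)
qed

lemma forest_forgetful_game: "forest forgetful_game"
proof -
  have bij: "bij_betw (move forgetful_game n) (profiles forgetful_game (T, n))
      (succs forgetful_game T n)"
    if "(T, n) \<in> dec_copies forgetful_game" for T n
    unfolding profiles_def forgetful_game_simps(5,7)
    by (rule bij_betw_eval_singleton)
      (use that in \<open>auto simp: succs_full_tree succs_low_tree dec_copies_def\<close>)
  have av: "avail forgetful_game j (T, n) \<noteq> {}"
    "avail forgetful_game j (T, n) \<subseteq> base_avail forgetful_game j n" for j T n
    by auto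
  have copies: "\<forall>(T, n)\<in>dec_copies forgetful_game.
      (\<forall>j\<in>active forgetful_game n. avail forgetful_game j (T, n) \<noteq> {} \<and>
        avail forgetful_game j (T, n) \<subseteq> base_avail forgetful_game j n) \<and>
      bij_betw (move forgetful_game n) (profiles forgetful_game (T, n)) (succs forgetful_game T n)"
    by (intro ballI, split prod.split) (use bij av in blast)
  have sub: "subtree forgetful_game T" if T: "T \<in> trees forgetful_game" for T
  proof -
    have "T \<subseteq> full_tree" "0 \<in> T"
      using T by (cases "T = full_tree"; simp)+
    moreover have "is_tree forgetful_game T"
      using T is_tree_forgetful_game by simp
    ultimately show ?thesis
      unfolding subtree_def nodes_forgetful_game forgetful_game_simps(2) by blast
  qed
  \<comment> \<open>The two trees form a chain, so the larger of two trees is their join.\<close>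
  have join: "join_semilattice (trees forgetful_game)"
    unfolding join_semilattice_def by simp
  have convex: "k \<in> T" if T: "T \<in> trees forgetful_game" and n: "n \<in> T"
    and prec: "prec forgetful_game m k \<and> prec forgetful_game k n" for T m n k
  proof -
    \<comment> \<open>A node with something below it is 0, 2 or 3. The first two lie in both trees,
      and node 3 precedes only 6 and 7, whose presence forces \<open>T\<close> to be the full
      tree.\<close>
    consider "k \<in> {0, 2}" | "k = 3" "n = 6 \<or> n = 7"
      using prec unfolding forgetful_game_simps(4) tree_prec_def by blast
    then show ?thesis
    proof cases
      case 1
      then show ?thesis using T by (cases "T = full_tree") auto
    next
      case 2
      then show ?thesis using T n by (cases "T = full_tree") auto
    qed
  qed
  have terminal: "n \<in> term_nodes forgetful_game"
    if T: "T \<in> trees forgetful_game" and n: "n \<in> T" "succs forgetful_game T n = {}" for T n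
  proof -
    consider "T = low_tree" "n \<notin> {0, 2}" | "T = full_tree" "n \<notin> {0, 2, 3}"
      using T n(2) by (auto simp: succs_full_tree succs_low_tree split: if_splits)
    then show ?thesis
      using n(1) by cases (simp; blast)+
  qed
  \<comment> \<open>Actions at the root are disjoint from those at 2 and 3, and within one tree each
    of the two kinds of node has a single action set.\<close>
  have avail_eq: "avail forgetful_game j (T, n) = avail forgetful_game j (T, n')"
    if "avail forgetful_game j (T, n) \<inter> avail forgetful_game j (T, n') \<noteq> {}" for j T n n'
    using that by (auto split: if_splits)
  show ?thesis
    unfolding forest_def
    by (intro conjI copies) (use sub join convex terminal avail_eq in \<open>simp; fail | blast\<close>)+
qed

section \<open>Information sets, (DA) and perfect recall\<close>

text \<open>Each of these sets is nonempty and all its copies carry the same tree, so it lies in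
  exactly one tree.\<close>

lemma lies_in_info [simp]:
  "lies_in root_info T \<longleftrightarrow> T = low_tree"
  "lies_in full_info T \<longleftrightarrow> T = full_tree"
  "lies_in low_info T \<longleftrightarrow> T = low_tree"
  by (auto simp: lies_in_def root_info_def full_info_def low_info_def)

lemma unawareness_game_forgetful_game: "unawareness_game forgetful_game"
proof -
  have "info_sets_wf forgetful_game 0"
    unfolding info_sets_wf_def dec_copies_of_eq
    by (auto simp: root_info_def full_info_def low_info_def)
  moreover have "I2 forgetful_game 0"
    unfolding I2_def dec_copies_of_eq by auto
  moreover have "I3 forgetful_game 0"
    unfolding I3_def dec_copies_of_iff
    by (auto simp: dec_copies_of_eq tree_path_full_tree tree_path_low_tree tree_prec_def)
  \<comment> \<open>The inclusion is strict at the root of the full tree, where {1, 2} is compared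
    with {1, 2, 3}.\<close>
  moreover have "I4 forgetful_game 0"
    unfolding I4_def dec_copies_of_eq by auto
  \<comment> \<open>Within one tree the action set tells the root from the later nodes, and the
    information set depends on nothing else.\<close>
  moreover have "I5 forgetful_game 0"
    unfolding I5_def dec_copies_of_iff by (auto split: if_splits)
  moreover have "U0 forgetful_game 0"
    unfolding U0_def dec_copies_of_eq by auto
  moreover have "U1 forgetful_game 0"
    unfolding U1_def dec_copies_of_eq by auto
  moreover have "U4 forgetful_game 0"
    unfolding U4_def dec_copies_of_iff by auto
  moreover have "U5 forgetful_game 0"
    unfolding U5_def
  proof (intro ballI allI impI, elim conjE)
    fix T T' T'' n
    assume T: "T \<in> trees forgetful_game" "T \<subseteq> T'" "n \<in> T"
      and x: "(T'', n) \<in> dec_copies_of forgetful_game (Some 0)"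
      and h: "lies_in (info forgetful_game 0 (T'', n)) T'"
    have low: "T = low_tree" if "T' = low_tree"
      using T that by auto
    consider "n = 0" | "n = 2" "T'' = low_tree" | "n = 2" "T'' = full_tree"
      | "n = 3" "T'' = full_tree"
      using x unfolding dec_copies_of_iff by blast
    \<comment> \<open>Only in the third case does \<open>T\<close> differ from \<open>T'\<close>:
      node 3 has no copy in \<open>low_tree\<close>, so the copies of \<open>full_info\<close> there
      reduce to \<open>low_info\<close>.\<close>
    then consider "n = 0" "T = low_tree" "T' = low_tree"
      | "n = 2" "T'' = low_tree" "T = low_tree" "T' = low_tree"
      | "n = 2" "T'' = full_tree" "T = low_tree" "T' = full_tree"
      | "n = 2 \<or> n = 3" "T'' = full_tree" "T = full_tree" "T' = full_tree"
    proof cases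
      case 1
      then show ?thesis using that(1) h low by simp
    next
      case 2
      then show ?thesis using that(2) h low by simp
    next
      case 3
      then show ?thesis using that(3,4) h T(1) by auto
    next
      case 4
      then show ?thesis using that(4) h T(1,3) by auto
    qed
    then show "info forgetful_game 0 (T, n) =
        {(T, m) |m. (T', m) \<in> info forgetful_game 0 (T'', n) \<and> m \<in> T}"
      by cases (auto simp: root_info_def full_info_def low_info_def)
  qed
  ultimately show ?thesis
    unfolding unawareness_game_def using base_tree_forgetful_game forest_forgetful_game by simp
qed

text \<open>Two distinct decision nodes on a path start with the root, whose information set lies in
  the least tree.\<close>

lemma DA_forgetful_game: "DA forgetful_game"
  unfolding DA_def dec_copies_of_iff
  by (auto simp: tree_path_full_tree tree_path_low_tree tree_prec_def)

lemma not_perfect_recall_forgetful_game: "\<not> perfect_recall forgetful_game"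
proof
  assume "perfect_recall forgetful_game"
  then have "I6 forgetful_game 0"
    by (simp add: perfect_recall_def)
  \<comment> \<open>Recall is tested for node 3, which follows action 3, against node 2 in the same
    information set.\<close>
  note recall = this[unfolded I6_def, rule_format, of full_tree 0 3 3 "(full_tree, 2)",
      unfolded prod.case]
  have "leads forgetful_game full_tree 0 3 (Some 0) 3"
    by (simp add: leads_iff tree_path_full_tree)
  moreover have "(full_tree, 0) \<in> dec_copies_of forgetful_game (Some 0)"
    "(full_tree, 3) \<in> dec_copies_of forgetful_game (Some 0)"
    "(full_tree, 2) \<in> info forgetful_game 0 (full_tree, 3)"
    by (auto simp: dec_copies_of_iff)
  moreover have "(0::nat) \<noteq> 3"
    by simp
  ultimately obtain m where "leads forgetful_game full_tree m 2 (Some 0) 3"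
    using recall by blast
  \<comment> \<open>Action 3 is available only at the root, so \<open>m\<close> is 0; but then node
    2 would have to follow node 3.\<close>
  then have "3 \<in> avail forgetful_game (Some 0) (full_tree, m)"
    "tree_path forgetful_game full_tree (3 + (if m = 3 then 2 else 0)) 2"
    unfolding leads_iff by blast+
  then show False
    by (simp add: tree_path_full_tree tree_prec_def split: if_splits)
qed

section \<open>Strategies and probabilities of reaching nodes\<close>

lemma info_sets_eq: "info_sets forgetful_game 0 = {root_info, full_info, low_info}"
  unfolding info_sets_def dec_copies_of_eq by auto

lemma info_avail_simps [simp]:
  "info_avail forgetful_game 0 root_info = {1, 2}"
  "info_avail forgetful_game 0 full_info = {4, 5}"
  "info_avail forgetful_game 0 low_info = {4, 5}"
  by (auto simp: info_avail_def root_info_def full_info_def low_info_def)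

lemma pureD:
  assumes "t \<in> pure forgetful_game 0"
  shows "t root_info \<in> {1, 2}" "t full_info \<in> {4, 5}" "t low_info \<in> {4, 5}"
  using assms by (auto simp: pure_def info_sets_eq PiE_iff)

text \<open>Since action 3 is unavailable in \<open>root_info\<close>, node 3 and its successors are never reached.\<close>

lemma reaches_iff:
  assumes T: "T = full_tree \<and> h = full_info \<or> T = low_tree \<and> h = low_info"
    and s: "s 0 \<in> pure forgetful_game 0"
  shows "reaches forgetful_game s\<^sub>0 s T n \<longleftrightarrow>
    n = 0 \<or> n = s 0 root_info \<or> s 0 root_info = 2 \<and> n = s 0 h"
proof
  assume "reaches forgetful_game s\<^sub>0 s T n"
  then show "n = 0 \<or> n = s 0 root_info \<or> s 0 root_info = 2 \<and> n = s 0 h"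
    \<comment> \<open>A pure strategy chooses 1 or 2 at the root and 4 or 5 later, so the only
      decision nodes reached are 0 and possibly 2. At both, an action is the label of the node it
      leads to.\<close>
    by (induction rule: reaches.induct) (use T pureD[OF s] in \<open>auto\<close>)
next
  have 0: "reaches forgetful_game s\<^sub>0 s T 0"
    by (rule reaches.root) (use T in auto)
  have 1: "reaches forgetful_game s\<^sub>0 s T (s 0 root_info)"
    using reaches.step[OF 0] by simp
  have 2: "reaches forgetful_game s\<^sub>0 s T (s 0 h)" if "s 0 root_info = 2"
    using reaches.step[of forgetful_game s\<^sub>0 s T 2] 1 that T by auto
  assume "n = 0 \<or> n = s 0 root_info \<or> s 0 root_info = 2 \<and> n = s 0 h"
  then show "reaches forgetful_game s\<^sub>0 s T n"
    using 0 1 2 by auto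
qed

lemma rho_mixed_eq:
  assumes T: "T = full_tree \<and> h = full_info \<or> T = low_tree \<and> h = low_info"
    and \<sigma>: "\<sigma> \<in> mixed forgetful_game 0"
  shows "rho_mixed forgetful_game 0 (T, n) \<sigma> s =
    measure_pmf.prob \<sigma> {t. n = 0 \<or> n = t root_info \<or> t root_info = 2 \<and> n = t h}"
proof -
  have "reaches forgetful_game (fst s) ((snd s)(0 := t)) T n \<longleftrightarrow>
      n = 0 \<or> n = t root_info \<or> t root_info = 2 \<and> n = t h" if "t \<in> pure forgetful_game 0" for t
    using reaches_iff[OF T, of "(snd s)(0 := t)"] that by simp
  moreover have "t \<in> pure forgetful_game 0" if "pmf \<sigma> t \<noteq> 0" for t
    using \<sigma> that by (auto simp: mixed_def set_pmf_iff)
  ultimately show ?thesis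
    unfolding rho_mixed_def fst_conv snd_conv by (intro measure_prob_cong_0) blast+
qed

text \<open>Evaluates the actions that \<open>rho_behavior\<close> selects by definite description.
  The value \<open>n - 2\<close> reflects the shifted labels at node 3.\<close>

lemma the_leads:
  "n \<in> {1, 2, 3} \<Longrightarrow> (THE a. leads forgetful_game full_tree 0 n (Some 0) a) = n"
  "n \<in> {4, 5} \<Longrightarrow> (THE a. leads forgetful_game full_tree 0 n (Some 0) a) = 2"
  "n \<in> {6, 7} \<Longrightarrow> (THE a. leads forgetful_game full_tree 0 n (Some 0) a) = 3"
  "n \<in> {4, 5} \<Longrightarrow> (THE a. leads forgetful_game full_tree 2 n (Some 0) a) = n"
  "n \<in> {6, 7} \<Longrightarrow> (THE a. leads forgetful_game full_tree 3 n (Some 0) a) = n - 2"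
  "n \<in> {1, 2} \<Longrightarrow> (THE a. leads forgetful_game low_tree 0 n (Some 0) a) = n"
  "n \<in> {4, 5} \<Longrightarrow> (THE a. leads forgetful_game low_tree 0 n (Some 0) a) = 2"
  "n \<in> {4, 5} \<Longrightarrow> (THE a. leads forgetful_game low_tree 2 n (Some 0) a) = n"
  by (rule the_equality;
      auto simp: leads_iff tree_path_full_tree tree_path_low_tree tree_prec_def)+

text \<open>No other agent is active anywhere, so the test on the opponents never yields 0 and only
  the product along the path remains. Here \<beta> is arbitrary, which is why a factor for action 3
  occurs.\<close>

lemma rho_behavior_eq:
  assumes T: "T = full_tree \<and> h = full_info \<or> T = low_tree \<and> h = low_info" and n: "n \<in> T"
  shows "rho_behavior forgetful_game 0 (T, n) \<beta> s =
    (if n = 0 then 1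
     else if n \<in> {1, 2, 3} then pmf (\<beta> root_info) n
     else if n \<in> {4, 5} then pmf (\<beta> root_info) 2 * pmf (\<beta> h) n
     else pmf (\<beta> root_info) 3 * pmf (\<beta> h) (n - 2))"
proof -
  let ?M = "{m. m \<in> before forgetful_game (T, n) \<and> (T, m) \<in> dec_copies_of forgetful_game (Some 0)}"
  have "?M = (if n = 0 then {} else if n \<in> {1, 2, 3} then {0} else if n \<in> {4, 5} then {0, 2} else {0, 3})"
    using T n by (auto simp: before_def dec_copies_of_iff tree_prec_def)
  then show ?thesis
    using T n unfolding rho_behavior_def Let_def by (auto simp: the_leads)
qed

section \<open>The equivalent behavior strategy\<close>

text \<open>The chain rule for conditional probability. If \<open>A\<close> is a null event there is
  nothing to condition on; \<open>p\<close> then serves as a default and both sides vanish.\<close>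

lemma prob_Int_eq_prob_times_prob_cond_pmf:
  "measure_pmf.prob p (A \<inter> B) =
    measure_pmf.prob p A * measure_pmf.prob (if set_pmf p \<inter> A = {} then p else cond_pmf p A) B"
proof (cases "set_pmf p \<inter> A = {}")
  case True
  then have "measure_pmf.prob p A = 0" "measure_pmf.prob p (A \<inter> B) = 0"
    by (auto simp: measure_pmf_zero_iff)
  then show ?thesis by simp
next
  case False
  then have "measure_pmf.prob p A \<noteq> 0"
    by (simp add: measure_pmf_zero_iff)
  then show ?thesis
    using False by (simp add: cond_pmf.rep_eq measure_pmf.emeasure_eq_measure)
qed

lemma ex_equivalent_behavior:
  assumes \<sigma>: "\<sigma> \<in> mixed forgetful_game 0"
  shows "\<exists>\<beta>\<in>behavior forgetful_game 0. equivalent forgetful_game 0 \<sigma> \<beta>"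
proof -
  define A :: "(nat copy set \<Rightarrow> nat) set" where "A = {t. t root_info = 2}"
  define \<tau> where "\<tau> = (if set_pmf \<sigma> \<inter> A = {} then \<sigma> else cond_pmf \<sigma> A)"
  \<comment> \<open>Taking marginals at single information sets is enough: no path meets both
    \<open>full_info\<close> and \<open>low_info\<close>, so their correlation is
    irrelevant.\<close>
  define \<beta> where "\<beta> = (\<lambda>h\<in>info_sets forgetful_game 0.
    map_pmf (\<lambda>t. t h) (if h = root_info then \<sigma> else \<tau>))"
  have \<sigma>_pure: "t \<in> pure forgetful_game 0" if "t \<in> set_pmf \<sigma>" for t
    using \<sigma> that by (auto simp: mixed_def)
  have \<tau>_pure: "t \<in> pure forgetful_game 0" if "t \<in> set_pmf \<tau>" for t
    using that \<sigma>_pure by (auto simp: \<tau>_def split: if_splits)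
  have "\<beta> \<in> behavior forgetful_game 0"
  proof -
    have "t h \<in> info_avail forgetful_game 0 h"
      if "t \<in> pure forgetful_game 0" "h \<in> info_sets forgetful_game 0" for t h
      using that unfolding pure_def by (rule PiE_mem)
    then show ?thesis
      unfolding behavior_def \<beta>_def using \<sigma>_pure \<tau>_pure
      by (auto simp del: info_avail_simps split: if_splits)
  qed
  moreover have "rho_mixed forgetful_game 0 (T, n) \<sigma> s = rho_behavior forgetful_game 0 (T, n) \<beta> s"
    if T: "T = full_tree \<and> h = full_info \<or> T = low_tree \<and> h = low_info" and n: "n \<in> T" for T n h s
  proof -
    have root: "pmf (\<beta> root_info) a = measure_pmf.prob \<sigma> {t. t root_info = a}" for a
      by (simp add: \<beta>_def info_sets_eq pmf_map vimage_def)
    have h: "pmf (\<beta> h) a = measure_pmf.prob \<tau> {t. t h = a}" for a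
      using T by (auto simp: \<beta>_def info_sets_eq pmf_map vimage_def)
    have joint: "measure_pmf.prob \<sigma> {t. t root_info = 2 \<and> t h = a} =
        pmf (\<beta> root_info) 2 * pmf (\<beta> h) a" for a
    proof -
      have "{t. t root_info = 2 \<and> t h = a} = A \<inter> {t. t h = a}"
        by (auto simp: A_def)
      then show ?thesis
        unfolding root h \<tau>_def
        by (simp only: prob_Int_eq_prob_times_prob_cond_pmf A_def)
    qed
    have "rho_mixed forgetful_game 0 (T, n) \<sigma> s =
      (if n = 0 then 1 else if n \<in> {1, 2, 3} then pmf (\<beta> root_info) n
       else measure_pmf.prob \<sigma> {t. t root_info = 2 \<and> t h = n})"
    proof (cases "n = 0")
      case True
      then show ?thesis
        by (simp add: rho_mixed_eq[OF T \<sigma>])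
    next
      case False
      have moves: "t root_info \<in> {1, 2} \<and> t h \<in> {4, 5}" if "pmf \<sigma> t \<noteq> 0" for t
        using pureD[OF \<sigma>_pure[of t]] that T by (auto simp: set_pmf_iff)
      let ?L = "{t. n = 0 \<or> n = t root_info \<or> t root_info = 2 \<and> n = t h}"
      \<comment> \<open>The labels of first and second moves are disjoint, so at most one of the
        last two alternatives in \<open>?L\<close> can hold on the support of \<sigma>.\<close>
      let ?R = "if n \<in> {1, 2, 3} then {t. t root_info = n} else {t. t root_info = 2 \<and> t h = n}"
      have same: "t \<in> ?L \<longleftrightarrow> t \<in> ?R" if "pmf \<sigma> t \<noteq> 0" for t
        using moves[OF that] False by (cases "n \<in> {1, 2, 3}") auto
      have "measure_pmf.prob \<sigma> ?L = measure_pmf.prob \<sigma> ?R"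
        by (rule measure_prob_cong_0) (use same in blast)+
      with False show ?thesis
        by (simp add: rho_mixed_eq[OF T \<sigma>] root)
    qed
    \<comment> \<open>This and the next fact settle nodes 6 and 7, where both reaching probabilities
      are 0.\<close>
    moreover have "pmf (\<beta> root_info) 3 = 0"
      unfolding root measure_pmf_zero_iff using pureD(1)[OF \<sigma>_pure] by fastforce
    moreover have "measure_pmf.prob \<sigma> {t. t root_info = 2 \<and> t h = n} = 0" if "n \<notin> {4, 5}"
    proof -
      have "t h \<in> {4, 5}" if "t \<in> set_pmf \<sigma>" for t
        using pureD(2,3)[OF \<sigma>_pure[OF that]] T by blast
      with that show ?thesis
        unfolding measure_pmf_zero_iff by blast
    qed
    ultimately show ?thesis
      unfolding rho_behavior_eq[OF T n] by (simp add: joint)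
  qed
  ultimately show ?thesis
    by (auto simp: equivalent_def all_copies_def)
qed

theorem mainTheorem3:
  "\<exists>\<Gamma> :: (nat, nat, nat) ugame.
     unawareness_game \<Gamma> \<and>
     (\<forall>i\<in>players \<Gamma>. \<forall>x\<in>dec_copies_of \<Gamma> (Some i). card (avail \<Gamma> (Some i) x) \<ge> 2) \<and>
     DA \<Gamma> \<and>
     (\<forall>i\<in>players \<Gamma>. \<forall>\<sigma>\<in>mixed \<Gamma> i. \<exists>\<beta>\<in>behavior \<Gamma> i. equivalent \<Gamma> i \<sigma> \<beta>) \<and>
     \<not> perfect_recall \<Gamma>"
proof (intro exI conjI)
  show "\<forall>i\<in>players forgetful_game. \<forall>x\<in>dec_copies_of forgetful_game (Some i).
      card (avail forgetful_game (Some i) x) \<ge> 2"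
    by (auto simp: dec_copies_of_eq)
qed (use ex_equivalent_behavior in \<open>auto intro: unawareness_game_forgetful_game DA_forgetful_game
      simp: not_perfect_recall_forgetful_game\<close>)

end
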